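(* Let $A\in\mathbb{R}^{n\times n}$, $B\in\mathbb{R}^{n\times r}$, $H\in\mathbb{R}^{p\times n}$, and consider the linear control system $\dot x(t)=Ax(t)+Bu(t)$, $y(t)=Hx(t)$. The feedback OR-system of this system is an exact system which contains full information on the dynamics of the original observers $y=Hx$. Explicitly: let $\mathcal{H}_*\subset\mathbb{R}^n_*$ be the span of the rows of $H$, let $\overline{\mathcal{H}}_*^{(A,B)}$ be its $(A,B)$-invariant closure, and let $V\in\mathbb{R}^{s\times n}$ be a matrix whose rows span $\overline{\mathcal{H}}_*^{(A,B)}$. Then there exist $F\in\mathbb{R}^{r\times n}$, $\Xi\in\mathbb{R}^{s\times s}$ and $T\in\mathbb{R}^{p\times s}$ such that for every $x(0)\in\mathbb{R}^n$ and every continuous input $v$, under the state feedback $u(t)=Fx(t)+v(t)$ the vector $z(t)=Vx(t)$ satisfies exactly $\dot z(t)=\Xi z(t)+VBv(t)$ and $y(t)=Tz(t)$.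
   Context: $\mathbb{R}^n_*$ denotes the space of row vectors of length $n$; a dual subspace is a linear subspace of it. A dual subspace $\mathcal{V}_*$ is $(A,B)$-invariant if there exists $F\in\mathbb{R}^{r\times n}$ with $\mathcal{V}_*(A+BF)\subset\mathcal{V}_*$. The $(A,B)$-invariant closure $\overline{\mathcal{H}}_*^{(A,B)}$ of $\mathcal{H}_*$ is the smallest $(A,B)$-invariant dual subspace containing $\mathcal{H}_*$; it exists and equals the annihilator of the largest subspace $W\subset\ker H$ for which $(A+BF)W\subset W$ for some $F$. The feedback OR-system (observer-based realization) of $\dot x=Ax+Bu$, $y=Hx$ is the system for the variables $z=Vx$, where the rows of $V$ span $\overline{\mathcal{H}}_*^{(A,B)}$ (i.e. this closure is used as the observer subspace), obtained under a feedback $u=Fx+v$ by expressing $\dot z$ in terms of $z$ and $v$; it is exact if the resulting equation holds along all trajectories of the closed-loop system. *)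

theory Defs
  imports "HOL-Analysis.Analysis"
begin

text \<open>Row vectors and column vectors of length \<open>n\<close> share the type \<open>real^'n\<close>; the row vector
  \<open>w\<close> acts on matrices from the left as \<open>w v* M\<close>.\<close>

definition AB_invariant :: "real^'n^'n \<Rightarrow> real^'r^'n \<Rightarrow> (real^'n) set \<Rightarrow> bool" where
  "AB_invariant A B W \<longleftrightarrow>
     subspace W \<and> (\<exists>F :: real^'n^'r. \<forall>w\<in>W. w v* (A + B ** F) \<in> W)"

text \<open>\<open>LEAST\<close> is with respect to set inclusion. The least element always exists, because
  \<open>AB_invariant A B\<close> holds of \<open>UNIV\<close> and is preserved by intersections: on annihilators the
  condition reads \<open>A X \<subseteq> X + range B\<close>, which is preserved by sums of subspaces.\<close>

definition AB_closure :: "real^'n^'n \<Rightarrow> real^'r^'n \<Rightarrow> (real^'n) set \<Rightarrow> (real^'n) set" where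
  "AB_closure A B S = (LEAST W. AB_invariant A B W \<and> S \<subseteq> W)"

definition trajectory ::
    "real^'n^'n \<Rightarrow> real^'r^'n \<Rightarrow> (real \<Rightarrow> real^'r) \<Rightarrow> (real \<Rightarrow> real^'n) \<Rightarrow> bool" where
  "trajectory A B u x \<longleftrightarrow>
     (\<forall>t\<ge>0. (x has_vector_derivative (A *v x t + B *v u t)) (at t within {0..}))"

end

theory Submission
  imports Defs
begin

text \<open>A subspace \<open>W\<close> of row vectors is \<open>(A,B)\<close>-invariant iff \<open>w A \<in> W\<close> for every \<open>w \<in> W\<close> with
  \<open>w B = 0\<close>: given a linear right inverse \<open>h\<close> of \<open>w \<mapsto> w B\<close> on \<open>W\<close>, the feedback \<open>y F = - (h y) A\<close> gives
  \<open>w (A + B F) = (w - h (w B)) A \<in> W\<close>. This condition is stable under intersections, so the closure exists and is itself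
  invariant under some \<open>A + B F\<close>. Hence the rows of \<open>V (A + B F)\<close> and of \<open>H\<close> lie in the row space of
  \<open>V\<close>, giving the factorizations \<open>V (A + B F) = \<Xi> V\<close> and \<open>H = T V\<close>.\<close>

lemma AB_invariant_iff:
  fixes A :: "real^'n^'n" and B :: "real^'r^'n"
  shows "AB_invariant A B W \<longleftrightarrow> subspace W \<and> (\<forall>w\<in>W. w v* B = 0 \<longrightarrow> w v* A \<in> W)"
proof (intro iffI conjI ballI impI)
  assume "AB_invariant A B W"
  then show "subspace W" by (simp add: AB_invariant_def)
next
  fix w assume "AB_invariant A B W" and w: "w \<in> W" "w v* B = 0"
  then obtain F :: "real^'n^'r" where "w v* (A + B ** F) \<in> W"
    by (auto simp: AB_invariant_def)
  moreover have "w v* (A + B ** F) = w v* A + (w v* B) v* F"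
    by (simp add: vector_matrix_mult_add_rdistrib vector_matrix_mul_assoc)
  ultimately show "w v* A \<in> W" using w by simp
next
  assume W: "subspace W \<and> (\<forall>w\<in>W. w v* B = 0 \<longrightarrow> w v* A \<in> W)"
  have "linear (\<lambda>w. w v* B)"
    using matrix_vector_mul_linear[of "transpose B"] by simp
  \<comment> \<open>The map \<open>w \<mapsto> w v* B\<close> need not be injective on
    \<open>W\<close>, so \<open>h\<close> only selects preimages, linearly. Having
    \<open>range h \<subseteq> W\<close> is what keeps \<open>w - h (w v* B)\<close> inside
    \<open>W\<close>.\<close>
  then obtain h where h: "range h \<subseteq> W" "linear h" "\<And>w. w \<in> W \<Longrightarrow> h (w v* B) v* B = w v* B"
    using linear_exists_right_inverse_on[of "\<lambda>w. w v* B" W] W by auto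
  have "linear (\<lambda>y. - (h y v* A))"
    using linear_compose[OF h(2) matrix_vector_mul_linear[of "transpose A"]]
    by (simp add: o_def linear_compose_neg)
  \<comment> \<open>\<open>matrix\<close> represents a linear map acting on columns, whereas
    \<open>F\<close> acts on row vectors from the right; hence the transpose.\<close>
  define F :: "real^'n^'r" where "F = transpose (matrix (\<lambda>y. - (h y v* A)))"
  have F: "y v* F = - (h y v* A)" for y
    unfolding F_def vector_transpose_matrix
    by (rule fun_cong[OF matrix_vector_mul(2)]) fact
  have "w v* (A + B ** F) \<in> W" if "w \<in> W" for w
  proof -
    let ?d = "w - h (w v* B)"
    have "?d \<in> W" using h(1) W that by (auto intro: subspace_diff)
    moreover have "?d v* B = 0" using h(3)[OF that] by (simp add: vector_matrix_mult_diff_distrib)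
    ultimately have "?d v* A \<in> W" using W by blast
    moreover have "w v* (A + B ** F) = ?d v* A"
      by (simp add: vector_matrix_mult_add_rdistrib vector_matrix_mult_diff_distrib F
          flip: vector_matrix_mul_assoc)
    ultimately show ?thesis by simp
  qed
  with W show "AB_invariant A B W" unfolding AB_invariant_def by blast
qed

text \<open>Different invariant subspaces may come with different feedbacks, so intersecting them is
  awkward with the definition. The feedback-free criterion passes to intersections at once, so the
  intersection of all candidates is itself a candidate and \<open>LEAST\<close> is attained.\<close>

lemma AB_closure:
  fixes A :: "real^'n^'n" and B :: "real^'r^'n"
  shows "AB_invariant A B (AB_closure A B S)" and "S \<subseteq> AB_closure A B S"
proof -
  let ?I = "\<Inter>{W. AB_invariant A B W \<and> S \<subseteq> W}"
  have "AB_invariant A B ?I"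
    by (auto simp: AB_invariant_iff intro!: subspace_Inter)
  moreover have "S \<subseteq> ?I" by blast
  moreover from calculation have "AB_closure A B S = ?I"
    unfolding AB_closure_def by (intro Least_equality) blast+
  ultimately show "AB_invariant A B (AB_closure A B S)" "S \<subseteq> AB_closure A B S" by simp_all
qed

lemma span_rows_eq_range:
  fixes V :: "real^'n^'s"
  shows "span (rows V) = range (\<lambda>c. c v* V)"
proof
  have "subspace (range (\<lambda>c. c v* V))"
    using linear_subspace_image[OF matrix_vector_mul_linear[of "transpose V"] subspace_UNIV] by simp
  moreover have "row i V = axis i 1 v* V" for i
    using matrix_vector_mult_basis[of "transpose V" i] by simp
  then have "rows V \<subseteq> range (\<lambda>c. c v* V)" by (auto simp: rows_def)
  ultimately show "span (rows V) \<subseteq> range (\<lambda>c. c v* V)" by (rule span_minimal[rotated])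
next
  show "range (\<lambda>c. c v* V) \<subseteq> span (rows V)"
    using matrix_vector_mult_in_columnspace[of "transpose V"] by auto
qed

lemma row_matrix_matrix_mult:
  fixes A :: "'a::semiring_1^'m^'k" and B :: "'a^'n^'m"
  shows "row i (A ** B) = row i A v* B"
  by (simp add: row_def matrix_matrix_mult_def vector_matrix_mult_def)

text \<open>Each row of \<open>M\<close> is a combination of the rows of \<open>V\<close>; stacking
  the coefficient vectors as rows gives \<open>T\<close>.\<close>

lemma factor_through_rows:
  fixes M :: "real^'n^'m" and V :: "real^'n^'s"
  assumes "\<And>i. row i M \<in> span (rows V)"
  obtains T where "M = T ** V"
proof -
  have "\<forall>i. \<exists>c. row i M = c v* V"
    using assms by (auto simp: span_rows_eq_range)
  then obtain c where c: "\<And>i. row i M = c i v* V" by metis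
  have "row i M = row i ((\<chi> i. c i) ** V)" for i
    by (simp add: c row_matrix_matrix_mult row_def[of i "\<chi> i. c i"])
  then have "M = (\<chi> i. c i) ** V" by (simp add: row_def vec_eq_iff)
  then show ?thesis by (rule that)
qed

theorem mainTheorem6:
  fixes A :: "real^'n^'n" and B :: "real^'r^'n" and H :: "real^'n^'p" and V :: "real^'n^'s"
  assumes "span (rows V) = AB_closure A B (span (rows H))"
  shows "\<exists>(F :: real^'n^'r) (\<Xi> :: real^'s^'s) (T :: real^'s^'p).
    \<forall>(x0 :: real^'n) (v :: real \<Rightarrow> real^'r). continuous_on {0..} v \<longrightarrow>
      (\<forall>(x :: real \<Rightarrow> real^'n) u y z.
         x 0 = x0 \<and> trajectory A B u x \<and>
         (\<forall>t\<ge>0. u t = F *v x t + v t) \<and> (\<forall>t\<ge>0. y t = H *v x t) \<and> (\<forall>t\<ge>0. z t = V *v x t) \<longrightarrow>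
         (\<forall>t\<ge>0. (z has_vector_derivative (\<Xi> *v z t + (V ** B) *v v t)) (at t within {0..})
                \<and> y t = T *v z t))"
proof -
  obtain F :: "real^'n^'r" where F: "\<And>w. w \<in> span (rows V) \<Longrightarrow> w v* (A + B ** F) \<in> span (rows V)"
    using AB_closure(1)[of A B "span (rows H)"] by (auto simp: assms AB_invariant_def)
  have "row i (V ** (A + B ** F)) \<in> span (rows V)" for i
    using F[of "row i V"] by (auto simp: row_matrix_matrix_mult rows_def intro: span_base)
  then obtain \<Xi> where \<Xi>: "V ** (A + B ** F) = \<Xi> ** V" using factor_through_rows by metis
  have "row i H \<in> span (rows H)" for i
    by (rule span_base) (auto simp: rows_def)
  then have "row i H \<in> span (rows V)" for i
    using AB_closure(2)[of "span (rows H)" A B] by (auto simp: assms)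
  then obtain T where T: "H = T ** V" using factor_through_rows by metis
  have z_deriv: "(z has_vector_derivative (\<Xi> *v z t + (V ** B) *v v t)) (at t within {0..})"
    if x: "trajectory A B u x" and u: "\<forall>t\<ge>0. u t = F *v x t + v t"
      and z: "\<forall>t\<ge>0. z t = V *v x t" and t: "t \<ge> 0" for x u v z and t :: real
  proof -
    have "((\<lambda>t. V *v x t) has_vector_derivative V *v (A *v x t + B *v u t)) (at t within {0..})"
      using x t
      by (intro bounded_linear.has_vector_derivative[OF matrix_vector_mul_bounded_linear])
        (simp add: trajectory_def)
    \<comment> \<open>Substituting \<open>u = F x + v\<close> closes the loop; the factorization
      through \<Xi> then leaves only \<open>z\<close> and \<open>v\<close>.\<close>
    moreover have "V *v (A *v x t + B *v u t) = (V ** (A + B ** F)) *v x t + (V ** B) *v v t"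
      using u t by (simp add: matrix_vector_right_distrib matrix_vector_mult_add_rdistrib
          matrix_vector_mul_assoc matrix_add_ldistrib matrix_mul_assoc)
    ultimately have "((\<lambda>t. V *v x t) has_vector_derivative (\<Xi> *v z t + (V ** B) *v v t))
        (at t within {0..})"
      using z t by (simp add: \<Xi> matrix_vector_mul_assoc)
    \<comment> \<open>\<open>z\<close> agrees with \<open>V x\<close> only for nonnegative times,
      which suffices for a derivative within \<open>{0..}\<close>, one-sided at 0.\<close>
    then show ?thesis
      by (rule has_vector_derivative_transform[rotated 2]) (use z t in auto)
  qed
  have "\<forall>t\<ge>0. y t = T *v z t" if "\<forall>t\<ge>0. y t = H *v x t" "\<forall>t\<ge>0. z t = V *v x t"
    for x y and z :: "real \<Rightarrow> real^'s"
    using that by (simp add: T matrix_vector_mul_assoc)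
  then show ?thesis
    by (intro exI[of _ F] exI[of _ \<Xi>] exI[of _ T] allI impI conjI; elim conjE)
      (rule z_deriv, assumption+, blast)
qed

end
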